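(* Let $\mathcal N$ be one of the algebras $\langle\mathbb N;\mathrm{Suc}\rangle$, $\langle\mathbb N;+\rangle$, $\langle\mathbb N;+,\times\rangle$. For any $f\colon\mathbb N\to\mathbb N$ the following are equivalent: (i) $f$ is $\mathcal N$-congruence preserving; (ii) (a) $|y-x|$ divides $|f(y)-f(x)|$ for all $x,y\in\mathbb N$, and (b) either $f$ is constant or $f(x)\ge x$ for all $x\in\mathbb N$.
   Context: An $\mathcal N$-congruence is an equivalence relation $\sim$ on $\mathbb N$ compatible with each operation of $\mathcal N$ (arguments pairwise equivalent imply values equivalent). $f$ is $\mathcal N$-congruence preserving if $x\sim y$ implies $f(x)\sim f(y)$ for every $\mathcal N$-congruence $\sim$. *)

theory Defs
  imports Main
begin

text \<open>An algebra whose universe is the whole type \<open>'a\<close> is given by its set of operations,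
  each a pair of an arity \<open>n\<close> and a function on argument lists; only the values on lists of
  length \<open>n\<close> matter.\<close>

type_synonym 'a operation = "nat \<times> ('a list \<Rightarrow> 'a)"
type_synonym 'a algebra = "'a operation set"

definition compatible :: "'a rel \<Rightarrow> 'a operation \<Rightarrow> bool" where
  "compatible R g \<longleftrightarrow>
     (\<forall>xs ys. length xs = fst g \<and> length ys = fst g \<and> (\<forall>i < fst g. (xs ! i, ys ! i) \<in> R)
        \<longrightarrow> (snd g xs, snd g ys) \<in> R)"

definition congruence :: "'a algebra \<Rightarrow> 'a rel \<Rightarrow> bool" where
  "congruence A R \<longleftrightarrow> equiv UNIV R \<and> (\<forall>g \<in> A. compatible R g)"

definition congruence_preserving :: "'a algebra \<Rightarrow> ('a \<Rightarrow> 'a) \<Rightarrow> bool" where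
  "congruence_preserving A f \<longleftrightarrow>
     (\<forall>R. congruence A R \<longrightarrow> (\<forall>x y. (x, y) \<in> R \<longrightarrow> (f x, f y) \<in> R))"

definition unary_op :: "('a \<Rightarrow> 'a) \<Rightarrow> 'a operation" where
  "unary_op h = (1, \<lambda>xs. h (xs ! 0))"

definition binary_op :: "('a \<Rightarrow> 'a \<Rightarrow> 'a) \<Rightarrow> 'a operation" where
  "binary_op h = (2, \<lambda>xs. h (xs ! 0) (xs ! 1))"

definition nat_Suc_algebra :: "nat algebra" where
  "nat_Suc_algebra = {unary_op Suc}"

definition nat_plus_algebra :: "nat algebra" where
  "nat_plus_algebra = {binary_op (+)}"

definition nat_plus_times_algebra :: "nat algebra" where
  "nat_plus_times_algebra = {binary_op (+), binary_op (*)}"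

end

theory Submission
  imports Defs
begin

text \<open>The congruences relating \<open>x\<close> and \<open>y\<close> when \<open>x = y\<close>, or when both are at least \<open>a\<close> and
  congruent modulo \<open>d\<close>, are shared by the three algebras. The pair \<open>a = 0\<close>, \<open>d = \<bar>y - x\<bar>\<close> gives
  the divisibility condition. If \<open>f a < a\<close>, the pair \<open>a\<close>, \<open>d = 1\<close> shows that \<open>f\<close> is constant from
  \<open>a\<close> on; then for every \<open>z\<close> the number \<open>f a - f z\<close> has arbitrarily large divisors and vanishes.
  Conversely, a congruence relating \<open>x\<close> and \<open>x + d\<close> is closed under \<open>Suc\<close> in all three algebras,
  hence relates any two numbers above \<open>x\<close> that differ by a multiple of \<open>d\<close>.\<close>

lemma compatible_unary_op:
  "compatible R (unary_op h) \<longleftrightarrow> (\<forall>x y. (x, y) \<in> R \<longrightarrow> (h x, h y) \<in> R)"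
proof
  assume c: "compatible R (unary_op h)"
  show "\<forall>x y. (x, y) \<in> R \<longrightarrow> (h x, h y) \<in> R"
  proof (intro allI impI)
    fix x y assume "(x, y) \<in> R"
    then show "(h x, h y) \<in> R"
      using c[unfolded compatible_def, rule_format, of "[x]" "[y]"] by (simp add: unary_op_def)
  qed
qed (simp add: compatible_def unary_op_def)

lemma compatible_binary_op:
  "compatible R (binary_op h) \<longleftrightarrow>
    (\<forall>x y u v. (x, y) \<in> R \<longrightarrow> (u, v) \<in> R \<longrightarrow> (h x u, h y v) \<in> R)"
proof
  assume c: "compatible R (binary_op h)"
  show "\<forall>x y u v. (x, y) \<in> R \<longrightarrow> (u, v) \<in> R \<longrightarrow> (h x u, h y v) \<in> R"
  proof (intro allI impI)
    fix x y u v assume "(x, y) \<in> R" "(u, v) \<in> R"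
    then show "(h x u, h y v) \<in> R"
      using c[unfolded compatible_def, rule_format, of "[x, u]" "[y, v]"]
      by (simp add: binary_op_def less_2_cases_iff all_conj_distrib)
  qed
qed (simp add: compatible_def binary_op_def)

definition cutoff_mod :: "nat \<Rightarrow> nat \<Rightarrow> nat rel" where
  "cutoff_mod a d = {(x, y). x = y \<or> (a \<le> x \<and> a \<le> y \<and> x mod d = y mod d)}"

lemma equiv_cutoff_mod: "equiv UNIV (cutoff_mod a d)"
  by (rule equivI) (auto simp: cutoff_mod_def refl_on_def sym_def trans_def)

lemma cutoff_mod_add:
  assumes "(x, y) \<in> cutoff_mod a d" "(u, v) \<in> cutoff_mod a d"
  shows "(x + u, y + v) \<in> cutoff_mod a d"
proof -
  have "(x + u) mod d = (y + v) mod d"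
    using assms by (intro mod_add_cong) (auto simp: cutoff_mod_def)
  then show ?thesis using assms by (auto simp: cutoff_mod_def)
qed

text \<open>Only the cutoff is delicate, since a product can fall below \<open>a\<close> when a
  factor is 0. If the zero factor comes from a pair of equal numbers, both products are 0 and hence
  equal; if it comes from a pair above the cutoff, then \<open>a = 0\<close>.\<close>

lemma cutoff_mod_mult:
  assumes "(x, y) \<in> cutoff_mod a d" "(u, v) \<in> cutoff_mod a d"
  shows "(x * u, y * v) \<in> cutoff_mod a d"
proof -
  have "(x * u) mod d = (y * v) mod d"
    using assms by (intro mod_mult_cong) (auto simp: cutoff_mod_def)
  moreover have le: "a \<le> p * q" if "a \<le> p \<and> (0 < q \<or> a \<le> q) \<or> a \<le> q \<and> 0 < p" for p q :: nat
    using that mult_le_mono[of a p 1 q] mult_le_mono[of 1 p a q] by (cases "q = 0") auto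
  moreover have "x * u = y * v \<or> (a \<le> x * u \<and> a \<le> y * v)"
    using assms le[of x u] le[of y v] by (auto simp: cutoff_mod_def)
  ultimately show ?thesis by (auto simp: cutoff_mod_def)
qed

lemma congruence_cutoff_mod:
  assumes "N \<in> {nat_Suc_algebra, nat_plus_algebra, nat_plus_times_algebra}"
  shows "congruence N (cutoff_mod a d)"
proof -
  have "(1, 1) \<in> cutoff_mod a d" by (simp add: cutoff_mod_def)
  then have "(Suc x, Suc y) \<in> cutoff_mod a d" if "(x, y) \<in> cutoff_mod a d" for x y
    using cutoff_mod_add[OF that] by fastforce
  then show ?thesis
    using assms by (auto simp: congruence_def equiv_cutoff_mod nat_Suc_algebra_def
        nat_plus_algebra_def nat_plus_times_algebra_def compatible_unary_op compatible_binary_op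
        cutoff_mod_add cutoff_mod_mult)
qed

lemma congruence_Suc:
  assumes "N \<in> {nat_Suc_algebra, nat_plus_algebra, nat_plus_times_algebra}"
    and R: "congruence N R" and "(x, y) \<in> R"
  shows "(Suc x, Suc y) \<in> R"
proof -
  \<comment> \<open>Where \<open>Suc\<close> is not an operation, it arises by adding this reflexive
    pair.\<close>
  have "(1, 1) \<in> R" using R by (auto simp: congruence_def equiv_def refl_on_def)
  moreover have "compatible R (unary_op Suc) \<or> compatible R (binary_op (+))"
    using assms by (auto simp: congruence_def nat_Suc_algebra_def nat_plus_algebra_def
        nat_plus_times_algebra_def)
  ultimately show ?thesis
    using \<open>(x, y) \<in> R\<close> by (fastforce simp: compatible_unary_op compatible_binary_op)
qed

text \<open>Shifting the pair by \<open>Suc\<close> relates \<open>w\<close> to \<open>w + d\<close>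
  for every \<open>w\<close> above \<open>x\<close>; transitivity chains these steps, and symmetry
  covers \<open>v < u\<close>.\<close>

lemma Suc_closed_equiv_mod:
  assumes R: "equiv UNIV R" and Suc: "\<And>x y. (x, y) \<in> R \<Longrightarrow> (Suc x, Suc y) \<in> R"
    and xd: "(x, x + d) \<in> R" and "x \<le> u" "x \<le> v" "int d dvd int v - int u"
  shows "(u, v) \<in> R"
proof -
  have step: "(x + k, x + k + d) \<in> R" for k
    using xd by (induction k) (auto dest: Suc)
  have iter: "(w, w + m * d) \<in> R" if "x \<le> w" for w m
  proof (induction m)
    case 0
    then show ?case using R by (simp add: equiv_def refl_on_def)
  next
    case (Suc m)
    have "(w + m * d, w + m * d + d) \<in> R"
      using step[of "w + m * d - x"] that by simp
    then show ?case using Suc.IH R by (auto simp: equiv_def ac_simps elim: transE)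
  qed
  have main: "(p, q) \<in> R" if "x \<le> p" "p \<le> q" "int d dvd int q - int p" for p q
  proof -
    have "d dvd q - p"
      using that by (metis int_dvd_int_iff of_nat_diff)
    then obtain m where "q - p = m * d" by (metis dvdE mult.commute)
    then have "q = p + m * d" using that by linarith
    then show ?thesis using iter that by simp
  qed
  show ?thesis
  proof (cases "u \<le> v")
    case True
    then show ?thesis using main assms by blast
  next
    case False
    then have "(v, u) \<in> R" using main assms by (simp add: dvd_diff_commute)
    then show ?thesis using R by (auto simp: equiv_def elim: symE)
  qed
qed

lemma eventually_constant_imp_constant:
  fixes f :: "nat \<Rightarrow> nat"
  assumes dvd: "\<And>x y. (int y - int x) dvd (int (f y) - int (f x))"
    and const: "\<And>y. a \<le> y \<Longrightarrow> f y = c"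
  shows "f z = c"
proof (rule ccontr)
  assume "f z \<noteq> c"
  \<comment> \<open>Large enough that \<open>f y = c\<close> and that \<open>y - z\<close> exceeds
    the distance between \<open>c\<close> and \<open>f z\<close>.\<close>
  define y where "y = a + z + f z + c + 1"
  have "(int y - int z) dvd (int c - int (f z))"
    using dvd[of y z] const[of y] by (simp add: y_def)
  then have "\<bar>int y - int z\<bar> \<le> \<bar>int c - int (f z)\<bar>"
    using \<open>f z \<noteq> c\<close> by (intro dvd_imp_le_int) auto
  then show False by (simp add: y_def)
qed

theorem theorem3p7:
  fixes N :: "nat algebra" and f :: "nat \<Rightarrow> nat"
  assumes "N \<in> {nat_Suc_algebra, nat_plus_algebra, nat_plus_times_algebra}"
  shows "congruence_preserving N f \<longleftrightarrow>
    (\<forall>x y :: nat. \<bar>int y - int x\<bar> dvd \<bar>int (f y) - int (f x)\<bar>) \<and>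
    ((\<exists>c. \<forall>x. f x = c) \<or> (\<forall>x. f x \<ge> x))"
proof
  assume "congruence_preserving N f"
  then have pres: "(f x, f y) \<in> cutoff_mod a d" if "(x, y) \<in> cutoff_mod a d" for x y a d
    using congruence_cutoff_mod[OF assms] that by (auto simp: congruence_preserving_def)
  have dvd: "(int y - int x) dvd (int (f y) - int (f x))" for x y
  proof -
    \<comment> \<open>If \<open>x = y\<close> then \<open>d = 0\<close>, and reduction modulo 0 is
      the identity, so this case runs along with the others.\<close>
    define d where "d = nat \<bar>int y - int x\<bar>"
    have d: "int d = \<bar>int y - int x\<bar>" by (simp add: d_def)
    have "int x mod int d = int y mod int d"
      by (simp add: d mod_eq_dvd_iff dvd_diff_commute[of _ "int x"])
    then have "x mod d = y mod d" by (metis of_nat_eq_iff zmod_int)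
    then have "(f x, f y) \<in> cutoff_mod 0 d" by (intro pres) (simp add: cutoff_mod_def)
    then have "f y mod d = f x mod d" by (auto simp: cutoff_mod_def)
    then have "int d dvd int (f y) - int (f x)" by (metis mod_eq_dvd_iff zmod_int)
    then show ?thesis by (simp add: d)
  qed
  have "\<exists>c. \<forall>x. f x = c" if "\<not> (\<forall>x. f x \<ge> x)"
  proof -
    from that obtain a where a: "f a < a" by (auto simp: not_le)
    \<comment> \<open>Modulo 1 all numbers agree, so \<open>a\<close> and \<open>y\<close> are
      related; but \<open>f a\<close> lies below the cutoff, where classes are singletons.\<close>
    have "f y = f a" if "a \<le> y" for y
      using pres[of a y a 1] that a by (simp add: cutoff_mod_def)
    then show ?thesis using eventually_constant_imp_constant[OF dvd] by blast
  qed
  then show "(\<forall>x y :: nat. \<bar>int y - int x\<bar> dvd \<bar>int (f y) - int (f x)\<bar>) \<and>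
      ((\<exists>c. \<forall>x. f x = c) \<or> (\<forall>x. f x \<ge> x))"
    using dvd by auto
next
  assume f: "(\<forall>x y :: nat. \<bar>int y - int x\<bar> dvd \<bar>int (f y) - int (f x)\<bar>) \<and>
      ((\<exists>c. \<forall>x. f x = c) \<or> (\<forall>x. f x \<ge> x))"
  show "congruence_preserving N f"
    unfolding congruence_preserving_def
  proof (intro allI impI)
    fix R x y assume R: "congruence N R" and xy: "(x, y) \<in> R"
    then have eq: "equiv UNIV R" by (simp add: congruence_def)
    have le: "(f p, f q) \<in> R" if "p \<le> q" "(p, q) \<in> R" for p q
    proof (cases "\<exists>c. \<forall>x. f x = c")
      case True
      then show ?thesis using eq by (auto simp: equiv_def refl_on_def)
    next
      case False
      then have ge: "x \<le> f x" for x using f by blast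
      have "int (q - p) dvd int (f q) - int (f p)"
        using f \<open>p \<le> q\<close> by (simp add: of_nat_diff)
      \<comment> \<open>The growth condition puts both values above \<open>p\<close>, in the range
        where \<open>R\<close> is known to contain congruence modulo \<open>q - p\<close>.\<close>
      moreover have "p \<le> f q" using \<open>p \<le> q\<close> ge[of q] by linarith
      ultimately show ?thesis
        using Suc_closed_equiv_mod[OF eq congruence_Suc[OF assms R], of p "q - p"] that ge[of p]
        by simp
    qed
    show "(f x, f y) \<in> R"
      using le[of x y] le[of y x] xy eq by (meson equiv_def nat_le_linear symE)
  qed
qed

end
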